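(* Let $\mathcal{L}$ be the family of all oriented paths on $\mathbb{N}$, i.e. all directed graphs $G$ with vertex set $\mathbb{N}$ such that for every $i\in\mathbb{N}$ exactly one of the ordered pairs $(i,i+1)$, $(i+1,i)$ is an edge of $G$, and $G$ has no other edges. Then $$\inf_{G\in\mathcal{L}} R(G)\;\geq\;\frac{\log 3}{3}\;>\;\frac12 .$$
   Context: For a directed graph $G$ with vertex set $\mathbb{N}$ and $n\in\mathbb{N}$, two permutations $\pi,\rho$ of $[n]=\{1,\dots,n\}$ are called $G$-different if there is $i\in[n]$ with $(\pi(i),\rho(i))\in E(G)$. A set of permutations is pairwise $G$-different if every two distinct members of it are $G$-different; note that since $G$ is directed, this requires for each pair $\pi\neq\rho$ both some $i$ with $(\pi(i),\rho(i))\in E(G)$ and some $j$ with $(\rho(j),\pi(j))\in E(G)$. $N(G,n)$ denotes the largest cardinality of a set of pairwise $G$-different permutations of $[n]$. The permutation capacity is $R(G)=\lim_{n\to\infty}\frac1n\log N(G,n)$ (this limit exists, possibly infinite, since $N(G,n)$ is supermultiplicative in $n$). All logarithms are to base 2. *)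

theory Defs
  imports
    "HOL-Combinatorics.Permutations"
    "HOL-Library.Extended_Real"
    "Graph_Theory.Pair_Digraph"
begin

(* Natural numbers start at 1 here, so graphs on them have vertex set {1..}. *)

definition G_different ::
    "nat pair_pre_digraph \<Rightarrow> nat \<Rightarrow> (nat \<Rightarrow> nat) \<Rightarrow> (nat \<Rightarrow> nat) \<Rightarrow> bool" where
  "G_different G n p q \<longleftrightarrow> (\<exists>i\<in>{1..n}. (p i, q i) \<in> parcs G)"

(* G_different G n is not symmetric in general; pairwise quantifies over ordered pairs
   of distinct members, so both directions are required. *)
definition pairwise_G_different :: "nat pair_pre_digraph \<Rightarrow> nat \<Rightarrow> (nat \<Rightarrow> nat) set \<Rightarrow> bool" where
  "pairwise_G_different G n S \<longleftrightarrow>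
     S \<subseteq> {p. p permutes {1..n}} \<and> pairwise (G_different G n) S"

definition max_G_different :: "nat pair_pre_digraph \<Rightarrow> nat \<Rightarrow> nat" where
  "max_G_different G n = Max {card S | S. pairwise_G_different G n S}"

(* The capacity is the limit of the following sequence. It is defined through liminf, so that it
   is meaningful without an existence proof for the limit; whenever the limit exists, finite or
   infinite, it is the value of permutation_capacity (lemma permutation_capacity_eq_limit). *)
definition permutation_capacity :: "nat pair_pre_digraph \<Rightarrow> ereal" where
  "permutation_capacity G = liminf (\<lambda>n. ereal (log 2 (real (max_G_different G n)) / real n))"

lemma permutation_capacity_eq_limit:
  assumes "(\<lambda>n. ereal (log 2 (real (max_G_different G n)) / real n)) \<longlonglongrightarrow> L"
  shows "permutation_capacity G = L"
  unfolding permutation_capacity_def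
  by (rule lim_imp_Liminf[OF sequentially_bot assms])

lemma max_G_different_attained:
  "\<exists>S. pairwise_G_different G n S \<and> card S = max_G_different G n"
  and max_G_different_upper:
  "pairwise_G_different G n S \<Longrightarrow> finite S \<and> card S \<le> max_G_different G n"
proof -
  have fin_perm: "finite {p. p permutes {1..n}}"
    by (simp add: finite_permutations)
  have "{S. pairwise_G_different G n S} \<subseteq> Pow {p. p permutes {1..n}}"
    by (auto simp: pairwise_G_different_def)
  then have "finite {S. pairwise_G_different G n S}"
    using fin_perm by (meson finite_Pow_iff finite_subset)
  then have fin: "finite {card S | S. pairwise_G_different G n S}"
    by simp
  have "pairwise_G_different G n {}"
    by (simp add: pairwise_G_different_def)
  then have ne: "{card S | S. pairwise_G_different G n S} \<noteq> {}"
    by blast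
  show "\<exists>S. pairwise_G_different G n S \<and> card S = max_G_different G n"
    using Max_in[OF fin ne] unfolding max_G_different_def by force
  show "finite S \<and> card S \<le> max_G_different G n" if "pairwise_G_different G n S"
    using that fin fin_perm unfolding max_G_different_def
    by (auto intro!: Max_ge simp: pairwise_G_different_def intro: finite_subset)
qed

definition oriented_paths :: "nat pair_pre_digraph set" where
  "oriented_paths = {G. pverts G = {1..} \<and>
     (\<forall>i\<ge>1. ((i, i + 1) \<in> parcs G) \<noteq> ((i + 1, i) \<in> parcs G)) \<and>
     parcs G \<subseteq> (\<Union>i\<in>{1..}. {(i, i + 1), (i + 1, i)})}"

end

theory Submission
  imports Defs "HOL-Real_Asymp.Real_Asymp"
begin

text \<open>
  Call a sequence of permutations of a block of symbols transitive if every earlier member is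
  \<open>G\<close>-different from every later one. For each orientation of a path on three consecutive
  vertices, the permutations 123, 231, 132 form a transitive sequence, in this order or in the
  reverse one. Cut \<open>[n]\<close> into \<open>t = n div 3\<close> such blocks and choose a member of the
  sequence in each. Two distinct choice vectors in \<open>{0,1,2}\<^sup>t\<close> with the same coordinate sum
  are incomparable, so the permutations they define are \<open>G\<close>-different in both directions.
  By pigeonhole some sum is attained by at least \<open>3\<^sup>t / (3t + 1)\<close> vectors.
\<close>

text \<open>Positions start at 1, so block \<open>j\<close> is open on the left and the quotient is
  taken of \<open>i - 1\<close>, not of \<open>i\<close>.\<close>

lemma block_index:
  fixes i j k :: nat
  assumes "i \<in> {k * j<..k * j + k}"
  shows "(i - 1) div k = j"
proof -
  from assms have "i - 1 = k * j + (i - 1 - k * j)" "i - 1 - k * j < k" by auto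
  then show ?thesis
    by (metis div_less div_mult_self4 add.commute add_0 less_zeroE)
qed

text \<open>The block index is invariant under the glued map, so injectivity reduces to one block at
  a time. Positions beyond \<open>k * t\<close>, left over when the blocks do not fill
  \<open>[n]\<close>, are fixed.\<close>

lemma permutes_blockwise:
  fixes k t n :: nat
  assumes perm: "\<And>j. j < t \<Longrightarrow> \<sigma> j permutes {k * j<..k * j + k}"
    and n: "k * t \<le> n"
  shows "(\<lambda>i. if i \<in> {1..k * t} then \<sigma> ((i - 1) div k) i else i) permutes {1..n}"
    (is "?g permutes _")
proof -
  have blk: "i \<in> {k * ((i - 1) div k)<..k * ((i - 1) div k) + k} \<and> (i - 1) div k < t"
    if i: "i \<in> {1..k * t}" for i
  proof -
    have "k > 0" using i by (cases k) auto
    then have "(i - 1) mod k < k" by simp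
    moreover have "k * ((i - 1) div k) + (i - 1) mod k = i - 1"
      by (rule mult_div_mod_eq)
    moreover have "(i - 1) div k < t"
      using i by (intro less_mult_imp_div_less) (auto simp: mult.commute)
    ultimately show ?thesis using i
      unfolding greaterThanAtMost_iff atLeastAtMost_iff by linarith
  qed
  have img: "?g i \<in> {1..k * t} \<and> (?g i - 1) div k = (i - 1) div k" if i: "i \<in> {1..k * t}" for i
  proof -
    let ?j = "(i - 1) div k"
    have j: "?j < t" and "i \<in> {k * ?j<..k * ?j + k}" using blk[OF i] by auto
    then have m: "\<sigma> ?j i \<in> {k * ?j<..k * ?j + k}"
      using permutes_in_image[OF perm[OF j]] by blast
    have "k * ?j + k = k * Suc ?j" by simp
    also have "\<dots> \<le> k * t" using j by (intro mult_le_mono2) simp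
    finally have "\<sigma> ?j i \<in> {1..k * t}" using m by auto
    then show ?thesis using i block_index[OF m] by simp
  qed
  have inj: "inj_on ?g {1..n}"
  proof (rule inj_onI)
    fix i i' assume eq: "?g i = ?g i'"
    show "i = i'"
    proof (cases "i \<in> {1..k * t}")
      case True
      then have i': "i' \<in> {1..k * t}" using eq img[OF True] by (metis (no_types, lifting))
      then have dv: "(i - 1) div k = (i' - 1) div k"
        using eq img[OF True] img[OF i'] by metis
      then have "\<sigma> ((i - 1) div k) i = \<sigma> ((i - 1) div k) i'" using eq True i' by simp
      then show ?thesis
        using permutes_inj[OF perm] blk[OF True] by (metis injD)
    next
      case False
      then have "i' \<notin> {1..k * t}" using eq img by (metis (no_types, lifting))
      then show ?thesis using eq False by (simp only: if_False)
    qed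
  qed
  have sub: "?g ` {1..n} \<subseteq> {1..n}"
  proof safe
    fix i assume i: "i \<in> {1..n}"
    show "?g i \<in> {1..n}"
    proof (cases "i \<in> {1..k * t}")
      case True
      then show ?thesis using img[OF True] n by auto
    next
      case False
      then show ?thesis using i by (simp only: if_False)
    qed
  qed
  \<comment> \<open>An injective self-map of a finite set is onto.\<close>
  have "bij_betw ?g {1..n} {1..n}"
    using inj endo_inj_surj[OF _ sub inj] by (simp add: bij_betw_def)
  then show ?thesis
    by (rule bij_imp_permutes) (use n in auto)
qed

text \<open>Otherwise \<open>x\<close> dominates \<open>y\<close> everywhere and strictly at
  \<open>i\<close>, which makes its sum larger.\<close>

lemma exists_less_of_sum_eq:
  fixes x y :: "'a \<Rightarrow> nat"
  assumes "finite A" "sum x A = sum y A" "x i \<noteq> y i" "i \<in> A"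
  shows "\<exists>j\<in>A. x j < y j"
proof (rule ccontr)
  assume "\<not> ?thesis"
  then have le: "\<forall>j\<in>A. y j \<le> x j" by (auto simp: not_less)
  then have "y i < x i" using assms by (simp add: order.not_eq_order_implies_strict)
  then have "sum y A < sum x A"
    using assms le by (intro sum_strict_mono_ex1) auto
  then show False using assms by simp
qed

lemma max_G_different_ge_transitive:
  fixes \<pi> :: "nat \<Rightarrow> nat \<Rightarrow> nat \<Rightarrow> nat"
  assumes perm: "\<And>j a. \<lbrakk>j < t; a < m\<rbrakk> \<Longrightarrow> \<pi> j a permutes {k * j<..k * j + k}"
    and edge: "\<And>j a b. \<lbrakk>j < t; a < b; b < m\<rbrakk> \<Longrightarrow>
      \<exists>i\<in>{k * j<..k * j + k}. (\<pi> j a i, \<pi> j b i) \<in> parcs G"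
    and irrefl: "\<And>v. (v, v) \<notin> parcs G"
    and n: "k * t \<le> n"
  shows "m ^ t \<le> (m * t + 1) * max_G_different G n"
proof -
  define X where "X = ({..<t} \<rightarrow>\<^sub>E {..<m} :: (nat \<Rightarrow> nat) set)"
  define F where "F s = {x \<in> X. sum x {..<t} = s}" for s
  define g where
    "g x i = (if i \<in> {1..k * t} then \<pi> ((i - 1) div k) (x ((i - 1) div k)) i else i)" for x i
  have finX: "finite X" unfolding X_def by (intro finite_PiE) auto
  have xm: "x j < m" if "x \<in> X" "j < t" for x j
    using that unfolding X_def by (auto simp: PiE_iff)
  \<comment> \<open>At a coordinate with \<open>x j < y j\<close>, the earlier member of the
    sequence of block \<open>j\<close> faces a later one. Exchanging \<open>x\<close> and
    \<open>y\<close> gives the other direction, possibly in a different block.\<close>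
  have diff: "G_different G n (g x) (g y)" if xy: "x \<in> F s" "y \<in> F s" "x \<noteq> y" for x y s
  proof -
    have X: "x \<in> X" "y \<in> X" using xy by (auto simp: F_def)
    then obtain i where "i < t" "x i \<noteq> y i"
      using PiE_ext[of x "{..<t}" _ y] \<open>x \<noteq> y\<close> unfolding X_def by blast
    then obtain j where j: "j < t" "x j < y j"
      using exists_less_of_sum_eq[of "{..<t}" x y i] xy unfolding F_def by auto
    obtain i where i: "i \<in> {k * j<..k * j + k}" "(\<pi> j (x j) i, \<pi> j (y j) i) \<in> parcs G"
      using edge[OF j xm[OF X(2) j(1)]] by blast
    have "k * j + k \<le> k * t"
      using j mult_le_mono2[of "Suc j" t k] by simp
    then have it: "i \<in> {1..k * t}" using i by auto
    have "(g x i, g y i) \<in> parcs G" using i it block_index[OF i(1)] unfolding g_def by simp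
    then show ?thesis using it n unfolding G_different_def by (intro bexI[of _ i]) auto
  qed
  have fiber: "card (F s) \<le> max_G_different G n" for s
  proof -
    \<comment> \<open>If distinct vectors gave the same permutation, it would be
      \<open>G\<close>-different from itself, which requires a loop.\<close>
    have inj: "inj_on g (F s)"
      using diff irrefl by (force simp: inj_on_def G_different_def)
    have "g x permutes {1..n}" if "x \<in> F s" for x
      unfolding g_def using that perm xm n
      by (intro permutes_blockwise[where \<sigma> = "\<lambda>j. \<pi> j (x j)"]) (auto simp: F_def)
    then have "pairwise_G_different G n (g ` F s)"
      unfolding pairwise_G_different_def pairwise_def using diff by blast
    then show ?thesis
      using max_G_different_upper card_image[OF inj] by metis
  qed
  \<comment> \<open>Hence at most \<open>m * t + 1\<close> fibers cover \<open>X\<close>. This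
    factor is linear in \<open>t\<close> and does not affect the exponential growth rate.\<close>
  have "sum x {..<t} \<le> m * t" if "x \<in> X" for x
    using sum_bounded_above[of "{..<t}" x m] xm[OF that] by (simp add: less_imp_le mult.commute)
  then have "X = (\<Union>s\<in>{..m * t}. F s)" by (auto simp: F_def)
  then have "card X \<le> (\<Sum>s\<le>m * t. card (F s))" by (simp add: card_UN_le)
  also have "\<dots> \<le> (m * t + 1) * max_G_different G n"
    using sum_bounded_above[of "{..m * t}" "\<lambda>s. card (F s)"] fiber by simp
  finally show ?thesis by (simp add: X_def card_PiE)
qed

text \<open>With \<open>p\<close>, \<open>q\<close>, \<open>r\<close> for 123, 231, 132:
  \<open>p\<close> and \<open>r\<close> show \<open>v\<close> against \<open>w\<close> in both
  orders, \<open>q\<close> and \<open>r\<close> show \<open>u\<close> against \<open>v\<close> in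
  both orders, so these two pairs differ both ways under any orientation. Only the pair
  \<open>p\<close>, \<open>q\<close> depends on it: \<open>p\<close> before \<open>q\<close> needs
  the edge \<open>(u, v)\<close> or \<open>(v, w)\<close>, and \<open>q\<close> before
  \<open>p\<close> needs \<open>(v, u)\<close> or \<open>(w, v)\<close>.\<close>

lemma oriented_path_transitive_block:
  assumes G: "G \<in> oriented_paths"
  shows "\<exists>\<pi> :: nat \<Rightarrow> nat \<Rightarrow> nat.
    (\<forall>a<3. \<pi> a permutes {c<..c + 3}) \<and>
    (\<forall>a b. a < b \<longrightarrow> b < 3 \<longrightarrow> (\<exists>i\<in>{c<..c + 3}. (\<pi> a i, \<pi> b i) \<in> parcs G))"
proof -
  define u v w where "u = c + 1" "v = c + 2" "w = c + 3"
  have blk: "{c<..c + 3} = {u, v, w}" by (auto simp: u_v_w_def)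
  have ne: "u \<noteq> v" "v \<noteq> w" "u \<noteq> w" by (auto simp: u_v_w_def)
  have uv: "((u, v) \<in> parcs G) \<noteq> ((v, u) \<in> parcs G)"
    using G unfolding oriented_paths_def u_v_w_def by (auto dest!: spec[of _ "c + 1"])
  have vw: "((v, w) \<in> parcs G) \<noteq> ((w, v) \<in> parcs G)"
    using G unfolding oriented_paths_def u_v_w_def
    by (auto dest!: spec[of _ "c + 2"] simp: numeral_3_eq_3)
  define p q r where "p = (id :: nat \<Rightarrow> nat)" "q = transpose u v \<circ> transpose v w"
    "r = transpose v w"
  have ev: "p u = u" "p v = v" "p w = w" "q u = v" "q v = w" "q w = u" "r u = u" "r v = w" "r w = v"
    using ne by (simp_all add: p_q_r_def)
  have perms: "p permutes {u, v, w}" "q permutes {u, v, w}" "r permutes {u, v, w}"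
    unfolding p_q_r_def by (auto intro!: permutes_compose permutes_swap_id permutes_id)
  have less3: "(\<forall>a b. a < b \<longrightarrow> b < (3::nat) \<longrightarrow> P a b) \<longleftrightarrow> P 0 1 \<and> P 0 2 \<and> P 1 2" for P
    by (auto simp: numeral_3_eq_3 numeral_2_eq_2 less_Suc_eq)
  have all3: "(\<forall>a<(3::nat). P a) \<longleftrightarrow> P 0 \<and> P 1 \<and> P 2" for P
    by (auto simp: numeral_3_eq_3 numeral_2_eq_2 less_Suc_eq)
  show ?thesis
  \<comment> \<open>Exactly when both edges point backwards, \<open>p\<close> fails to precede
    \<open>q\<close>, and the sequence is reversed.\<close>
  proof (cases "(w, v) \<in> parcs G \<and> (v, u) \<in> parcs G")
    case True
    then show ?thesis
      unfolding blk less3 all3 using perms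
      by (intro exI[of _ "\<lambda>a. if a = 0 then r else if a = 1 then q else p"]) (simp add: ev)
  next
    case False
    then show ?thesis
      unfolding blk less3 all3 using perms uv vw
      by (intro exI[of _ "\<lambda>a. if a = 0 then p else if a = 1 then q else r"]) (auto simp: ev)
  qed
qed

lemma max_G_different_oriented_path:
  assumes G: "G \<in> oriented_paths"
  shows "3 ^ (n div 3) \<le> (3 * (n div 3) + 1) * max_G_different G n"
proof -
  obtain \<pi> :: "nat \<Rightarrow> nat \<Rightarrow> nat \<Rightarrow> nat" where \<pi>:
    "\<And>c. (\<forall>a<3. \<pi> c a permutes {c<..c + 3}) \<and>
      (\<forall>a b. a < b \<longrightarrow> b < 3 \<longrightarrow> (\<exists>i\<in>{c<..c + 3}. (\<pi> c a i, \<pi> c b i) \<in> parcs G))"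
    using oriented_path_transitive_block[OF G] by metis
  have "(v, v) \<notin> parcs G" for v
    using G unfolding oriented_paths_def by auto
  then show ?thesis
    \<comment> \<open>Block \<open>j\<close> has offset \<open>c = 3 * j\<close>; its orientation,
      and so its sequence, may vary with \<open>j\<close>.\<close>
    using \<pi> by (intro max_G_different_ge_transitive[where \<pi> = "\<lambda>j. \<pi> (3 * j)" and k = 3]) auto
qed

lemma permutation_capacity_oriented_path:
  assumes G: "G \<in> oriented_paths"
  shows "ereal (log 2 3 / 3) \<le> permutation_capacity G"
proof -
  \<comment> \<open>A minorant free of \<open>div\<close>, from
    \<open>n div 3 \<ge> n / 3 - 1\<close> and \<open>3 * (n div 3) + 1 \<le> n + 1\<close>.\<close>
  define h where "h n = ((real n / 3 - 1) * log 2 3 - log 2 (real n + 1)) / real n" for n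
  have "h n \<le> log 2 (real (max_G_different G n)) / real n" if "n > 0" for n
  proof -
    define t N where "t = n div 3" "N = max_G_different G n"
    have le: "3 ^ t \<le> (3 * t + 1) * N"
      using max_G_different_oriented_path[OF G, of n] by (simp add: t_N_def)
    then have "N > 0" by (cases N) auto
    have "real (3 * t + 1) \<le> real (n + 1)"
      unfolding of_nat_le_iff by (simp add: t_N_def)
    then have t: "3 * real t + 1 \<le> real n + 1" by simp
    have "(3::real) ^ t \<le> real ((3 * t + 1) * N)"
      using le by (metis of_nat_le_iff of_nat_numeral of_nat_power)
    also have "\<dots> \<le> (real n + 1) * real N" using mult_right_mono[OF t, of "real N"] by (simp add: algebra_simps)
    finally have "log 2 (3 ^ t) \<le> log 2 ((real n + 1) * real N)"
      using \<open>N > 0\<close> by (subst log_le_cancel_iff) auto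
    then have "real t * log 2 3 \<le> log 2 (real n + 1) + log 2 (real N)"
      using \<open>N > 0\<close> by (simp add: log_nat_power log_mult)
    moreover have "(real n / 3 - 1) * log 2 3 \<le> real t * log 2 3"
      by (intro mult_right_mono) (auto simp: t_N_def)
    ultimately have "(real n / 3 - 1) * log 2 3 - log 2 (real n + 1) \<le> log 2 (real N)"
      by linarith
    then show ?thesis
      unfolding h_def t_N_def by (intro divide_right_mono) auto
  qed
  then have "eventually (\<lambda>n. ereal (h n) \<le> ereal (log 2 (real (max_G_different G n)) / real n))
      sequentially"
    by (intro eventually_sequentiallyI[of 1]) auto
  then have "liminf (\<lambda>n. ereal (h n)) \<le> permutation_capacity G"
    unfolding permutation_capacity_def by (rule Liminf_mono)
  moreover have "h \<longlonglongrightarrow> log 2 3 / 3"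
    unfolding h_def log_def by real_asymp
  then have "liminf (\<lambda>n. ereal (h n)) = ereal (log 2 3 / 3)"
    by (intro lim_imp_Liminf) auto
  ultimately show ?thesis by simp
qed

theorem theorem1:
  shows "(INF G\<in>oriented_paths. permutation_capacity G) \<ge> ereal (log 2 3 / 3)
    \<and> log 2 3 / 3 > (1 / 2 :: real)"
proof
  show "(INF G\<in>oriented_paths. permutation_capacity G) \<ge> ereal (log 2 3 / 3)"
    by (intro INF_greatest permutation_capacity_oriented_path)
  \<comment> \<open>The strict bound is \<open>8 < 9\<close> after taking logarithms.\<close>
  have "log 2 (2 ^ 3) < log 2 (3 ^ 2 :: real)" by (subst log_less_cancel_iff) auto
  then have "3 < 2 * log 2 (3 :: real)" by (simp only: log_nat_power) simp
  then show "log 2 3 / 3 > (1 / 2 :: real)" by simp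
qed

end
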